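(* Let $G$ be a graph and let $\ell$ be a weakly subadditive nonnegative integer-valued function on subsets of $V(G)$ with $\ell(\emptyset)=\ell(V(G))=0$. Then $G$ is minimally $\ell$-rigid if and only if $G$ has an $\ell$-arc-connected orientation such that $d^-_G(v)=\ell(v)$ for each vertex $v$.
   Context: Graphs are finite, loopless, multiple edges allowed. $e_G(X)$ is the number of edges with both ends in $X$; $\ell(v)=\ell(\{v\})$; weakly subadditive means $\sum_{v\in A}\ell(v)\ge\ell(A)$ for all $A$. $G$ is minimally $\ell$-rigid if $e_G(X)\le\sum_{v\in X}\ell(v)-\ell(X)$ for all $X\subseteq V(G)$ and $|E(G)|=\sum_{v\in V(G)}\ell(v)-\ell(V(G))$ (equivalently, $G$ is $\ell$-rigid but no proper spanning subgraph is). In an orientation, $d^-(v)$ is the number of arcs entering $v$ and $d^-(A)$ is the number of arcs entering $A$ (tail outside $A$, head in $A$); the orientation is $\ell$-arc-connected if $d^-(A)\ge\ell(A)$ for every vertex set $A$. *)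

theory Defs
  imports "Graph_Theory.Digraph"
begin

(* Undirected multigraphs: edges are abstract objects, so parallel edges are distinct
   elements of the edge set with the same two-element set of ends. *)
record ('v, 'e) multigraph =
  vertices :: "'v set"
  edges :: "'e set"
  ends :: "'e \<Rightarrow> 'v set"

locale finite_multigraph =
  fixes G :: "('v, 'e) multigraph"
  assumes finite_vertices: "finite (vertices G)"
    and finite_edges: "finite (edges G)"
    and ends_subset: "e \<in> edges G \<Longrightarrow> ends G e \<subseteq> vertices G"
    and card_ends: "e \<in> edges G \<Longrightarrow> card (ends G e) = 2"

definition induced_edge_count :: "('v, 'e) multigraph \<Rightarrow> 'v set \<Rightarrow> nat" where
  "induced_edge_count G X = card {e \<in> edges G. ends G e \<subseteq> X}"

definition weakly_subadditive_on :: "'v set \<Rightarrow> ('v set \<Rightarrow> int) \<Rightarrow> bool" where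
  "weakly_subadditive_on V l \<longleftrightarrow> (\<forall>A\<subseteq>V. l A \<le> (\<Sum>v\<in>A. l {v}))"

definition minimally_rigid :: "('v set \<Rightarrow> int) \<Rightarrow> ('v, 'e) multigraph \<Rightarrow> bool" where
  "minimally_rigid l G \<longleftrightarrow>
     (\<forall>X\<subseteq>vertices G. int (induced_edge_count G X) \<le> (\<Sum>v\<in>X. l {v}) - l X) \<and>
     int (card (edges G)) = (\<Sum>v\<in>vertices G. l {v}) - l (vertices G)"

definition orientation_of :: "('v, 'e) pre_digraph \<Rightarrow> ('v, 'e) multigraph \<Rightarrow> bool" where
  "orientation_of D G \<longleftrightarrow>
     verts D = vertices G \<and> arcs D = edges G \<and>
     (\<forall>e\<in>edges G. {tail D e, head D e} = ends G e)"

definition set_in_degree :: "('v, 'e) pre_digraph \<Rightarrow> 'v set \<Rightarrow> nat" where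
  "set_in_degree D A = card {e \<in> arcs D. tail D e \<notin> A \<and> head D e \<in> A}"

definition arc_connected :: "('v set \<Rightarrow> int) \<Rightarrow> ('v, 'e) pre_digraph \<Rightarrow> bool" where
  "arc_connected l D \<longleftrightarrow> (\<forall>A\<subseteq>verts D. l A \<le> int (set_in_degree D A))"

end

theory Submission
  imports Defs
begin

text \<open>
  In an orientation, the arcs with head in \<open>A\<close> either enter \<open>A\<close> or lie inside \<open>A\<close>, so the number
  of arcs entering \<open>A\<close> is the sum of the in-degrees over \<open>A\<close> minus the number of edges induced by
  \<open>A\<close>. Once the in-degrees are prescribed by \<open>l\<close>, arc-connectivity is therefore the same as
  sparsity. What remains is Hakimi's theorem on orientations with prescribed in-degrees. As in
  Rado's proof of Hall's theorem, hyperedges are shrunk to single vertices one at a time. A vertex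
  to which a hyperedge cannot be shrunk lies in a set that is tight already without that hyperedge.
  Tight sets are closed under union, so if no vertex of the hyperedge worked, the union of all
  these sets would be tight without the hyperedge and yet contain it.
\<close>

definition spanned :: "('e \<Rightarrow> 'v set) \<Rightarrow> 'e set \<Rightarrow> 'v set \<Rightarrow> 'e set" where
  "spanned I E X = {e \<in> E. I e \<subseteq> X}"

definition sparse :: "('v \<Rightarrow> nat) \<Rightarrow> 'v set \<Rightarrow> ('e \<Rightarrow> 'v set) \<Rightarrow> 'e set \<Rightarrow> bool" where
  "sparse m V I E \<longleftrightarrow> (\<forall>X\<subseteq>V. card (spanned I E X) \<le> sum m X)"

definition tight :: "('v \<Rightarrow> nat) \<Rightarrow> ('e \<Rightarrow> 'v set) \<Rightarrow> 'e set \<Rightarrow> 'v set \<Rightarrow> bool" where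
  "tight m I E X \<longleftrightarrow> card (spanned I E X) = sum m X"

lemma sparseD: "sparse m V I E \<Longrightarrow> X \<subseteq> V \<Longrightarrow> card (spanned I E X) \<le> sum m X"
  by (simp add: sparse_def)

lemma finite_spanned: "finite E \<Longrightarrow> finite (spanned I E X)"
  by (simp add: spanned_def)

lemma spanned_mono: "E \<subseteq> F \<Longrightarrow> X \<subseteq> Y \<Longrightarrow> spanned I E X \<subseteq> spanned I F Y"
  by (auto simp: spanned_def)

lemma sparse_subset:
  assumes "sparse m V I E" "F \<subseteq> E" "finite E"
  shows "sparse m V I F"
  unfolding sparse_def
proof (intro allI impI)
  fix X assume "X \<subseteq> V"
  have "card (spanned I F X) \<le> card (spanned I E X)"
    using assms by (intro card_mono finite_spanned spanned_mono) auto
  also have "\<dots> \<le> sum m X"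
    using assms(1) \<open>X \<subseteq> V\<close> by (rule sparseD)
  finally show "card (spanned I F X) \<le> sum m X" .
qed

lemma card_spanned_remove:
  assumes "finite E" "e \<in> E"
  shows "card (spanned I E X) = card (spanned I (E - {e}) X) + of_bool (I e \<subseteq> X)"
proof (cases "I e \<subseteq> X")
  case True
  then have "spanned I E X = insert e (spanned I (E - {e}) X)" "e \<notin> spanned I (E - {e}) X"
    using \<open>e \<in> E\<close> by (auto simp: spanned_def)
  then show ?thesis
    using True \<open>finite E\<close> by (simp add: finite_spanned)
next
  case False
  then have "spanned I E X = spanned I (E - {e}) X"
    by (auto simp: spanned_def)
  then show ?thesis
    using False by simp
qed

lemma card_spanned_supermodular:
  assumes "finite E"
  shows "card (spanned I E X) + card (spanned I E Y)
    \<le> card (spanned I E (X \<union> Y)) + card (spanned I E (X \<inter> Y))"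
proof -
  have "card (spanned I E X) + card (spanned I E Y)
      = card (spanned I E X \<union> spanned I E Y) + card (spanned I E X \<inter> spanned I E Y)"
    using assms by (intro card_Un_Int finite_spanned)
  also have "spanned I E X \<inter> spanned I E Y = spanned I E (X \<inter> Y)"
    by (auto simp: spanned_def)
  also have "card (spanned I E X \<union> spanned I E Y) \<le> card (spanned I E (X \<union> Y))"
    using assms by (intro card_mono finite_spanned Un_least spanned_mono) auto
  finally show ?thesis by simp
qed

lemma tight_Un:
  assumes "finite V" "finite E" "sparse m V I E" "X \<subseteq> V" "Y \<subseteq> V" "tight m I E X" "tight m I E Y"
  shows "tight m I E (X \<union> Y)"
proof -
  have "sum m (X \<union> Y) + sum m (X \<inter> Y) = card (spanned I E X) + card (spanned I E Y)"
    using assms finite_subset[of _ V] by (simp add: tight_def sum.union_inter)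
  also have "\<dots> \<le> card (spanned I E (X \<union> Y)) + card (spanned I E (X \<inter> Y))"
    using \<open>finite E\<close> by (rule card_spanned_supermodular)
  finally have "sum m (X \<union> Y) + sum m (X \<inter> Y)
    \<le> card (spanned I E (X \<union> Y)) + card (spanned I E (X \<inter> Y))" .
  moreover have "card (spanned I E (X \<union> Y)) \<le> sum m (X \<union> Y)"
    using assms by (intro sparseD) auto
  moreover have "card (spanned I E (X \<inter> Y)) \<le> sum m (X \<inter> Y)"
    using assms by (intro sparseD) auto
  ultimately show ?thesis
    by (simp add: tight_def)
qed

lemma tight_Union:
  assumes "finite V" "finite E" "sparse m V I E"
    and "finite \<X>" "\<And>X. X \<in> \<X> \<Longrightarrow> X \<subseteq> V" "\<And>X. X \<in> \<X> \<Longrightarrow> tight m I E X"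
  shows "tight m I E (\<Union>\<X>)"
  using assms(4-6)
proof (induction \<X> rule: finite_induct)
  case empty
  show ?case
    using sparseD[OF assms(3), of "{}"] by (simp add: tight_def)
next
  case (insert X \<X>)
  have "tight m I E (X \<union> \<Union>\<X>)"
  proof (rule tight_Un[OF assms(1-3)])
    show "\<Union>\<X> \<subseteq> V" "X \<subseteq> V"
      using insert.prems(1) by auto
  qed (use insert in auto)
  then show ?case by simp
qed

lemma not_sparse_shrink_imp_tight:
  assumes "finite E" "e \<in> E" "sparse m V I E" "\<not> sparse m V (I(e := {w})) E"
  obtains X where "X \<subseteq> V" "w \<in> X" "tight m I (E - {e}) X"
proof -
  obtain X where "X \<subseteq> V" and dense: "sum m X < card (spanned (I(e := {w})) E X)"
    using assms(4) by (auto simp: sparse_def not_le)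
  have "spanned (I(e := {w})) (E - {e}) X = spanned I (E - {e}) X"
    by (auto simp: spanned_def)
  then have "sum m X < card (spanned I (E - {e}) X) + of_bool (w \<in> X)"
    using dense card_spanned_remove[OF assms(1,2), of "I(e := {w})" X] by simp
  moreover have "card (spanned I (E - {e}) X) \<le> sum m X"
    using sparse_subset[OF assms(3) Diff_subset \<open>finite E\<close>] \<open>X \<subseteq> V\<close> by (rule sparseD)
  ultimately have "w \<in> X" "tight m I (E - {e}) X"
    by (auto simp: tight_def of_bool_def split: if_splits)
  with \<open>X \<subseteq> V\<close> show thesis by (rule that)
qed

lemma sparse_imp_ex_sparse_shrink:
  assumes "finite V" "finite E" "e \<in> E" "sparse m V I E"
  shows "\<exists>w\<in>I e. sparse m V (I(e := {w})) E"
proof (rule ccontr)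
  assume not_sparse: "\<not> ?thesis"
  define Z where "Z = \<Union>{X. X \<subseteq> V \<and> tight m I (E - {e}) X}"
  have "Z \<subseteq> V"
    by (auto simp: Z_def)
  have "I e \<subseteq> Z"
  proof
    fix w assume "w \<in> I e"
    then obtain X where "X \<subseteq> V" "w \<in> X" "tight m I (E - {e}) X"
      using not_sparse not_sparse_shrink_imp_tight[OF assms(2-4)] by blast
    then show "w \<in> Z"
      by (auto simp: Z_def)
  qed
  have "tight m I (E - {e}) Z"
    unfolding Z_def using assms
    by (intro tight_Union[of V] sparse_subset[of m V I E "E - {e}"]) auto
  then have "card (spanned I E Z) = sum m Z + 1"
    using card_spanned_remove[OF assms(2,3), of I Z] \<open>I e \<subseteq> Z\<close> by (simp add: tight_def)
  moreover have "card (spanned I E Z) \<le> sum m Z"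
    using assms(4) \<open>Z \<subseteq> V\<close> by (rule sparseD)
  ultimately show False by simp
qed

lemma sparse_imp_ex_sparse_override_singletons:
  assumes "finite V" "finite E" "sparse m V I E" "F \<subseteq> E"
  shows "\<exists>h. (\<forall>e\<in>F. h e \<in> I e) \<and> sparse m V (override_on I (\<lambda>e. {h e}) F) E"
  using finite_subset[OF assms(4,2)] assms(4)
proof (induction F rule: finite_subset_induct')
  case empty
  then show ?case
    using assms(3) by simp
next
  case (insert e F)
  then obtain h where h: "\<forall>e\<in>F. h e \<in> I e"
    and "sparse m V (override_on I (\<lambda>e. {h e}) F) E"
    by blast
  then obtain w where "w \<in> override_on I (\<lambda>e. {h e}) F e"
    and "sparse m V ((override_on I (\<lambda>e. {h e}) F)(e := {w})) E"
    using sparse_imp_ex_sparse_shrink[OF assms(1,2) \<open>e \<in> E\<close>] by blast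
  moreover have "(override_on I (\<lambda>e. {h e}) F)(e := {w})
      = override_on I (\<lambda>f. {(h(e := w)) f}) (insert e F)"
    by (simp add: override_on_def fun_eq_iff)
  ultimately have "\<forall>f\<in>insert e F. (h(e := w)) f \<in> I f"
    and "sparse m V (override_on I (\<lambda>f. {(h(e := w)) f}) (insert e F)) E"
    using h \<open>e \<notin> F\<close> by simp_all
  then show ?case by blast
qed

theorem sparse_imp_ex_heads_card_le:
  assumes "finite V" "finite E" "sparse m V I E"
  shows "\<exists>h. (\<forall>e\<in>E. h e \<in> I e) \<and> (\<forall>v\<in>V. card {e \<in> E. h e = v} \<le> m v)"
proof -
  obtain h where h: "\<forall>e\<in>E. h e \<in> I e"
    and sparse: "sparse m V (override_on I (\<lambda>e. {h e}) E) E"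
    using sparse_imp_ex_sparse_override_singletons[OF assms subset_refl] by blast
  have "card {e \<in> E. h e = v} \<le> m v" if "v \<in> V" for v
  proof -
    have "{e \<in> E. h e = v} = spanned (override_on I (\<lambda>e. {h e}) E) E {v}"
      by (auto simp: spanned_def)
    then show ?thesis
      using sparseD[OF sparse, of "{v}"] that by simp
  qed
  with h show ?thesis by blast
qed

context finite_multigraph
begin

lemma induced_edge_count_eq_card_spanned:
  "induced_edge_count G X = card (spanned (ends G) (edges G) X)"
  by (simp add: induced_edge_count_def spanned_def)

lemma card_heads_in_eq_sum_in_degree:
  assumes "orientation_of D G" "A \<subseteq> vertices G"
  shows "card {e \<in> edges G. head D e \<in> A} = (\<Sum>v\<in>A. in_degree D v)"
proof -
  have arcs: "arcs D = edges G"
    using assms(1) by (simp add: orientation_of_def)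
  then have "{e \<in> edges G. head D e \<in> A} = (\<Union>v\<in>A. in_arcs D v)"
    unfolding in_arcs_def by blast
  also have "card \<dots> = (\<Sum>v\<in>A. card (in_arcs D v))"
  proof (rule card_UN_disjoint)
    show "finite A"
      using assms(2) finite_vertices by (rule finite_subset)
    show "\<forall>v\<in>A. finite (in_arcs D v)"
      using finite_edges by (simp add: in_arcs_def arcs)
    show "\<forall>u\<in>A. \<forall>v\<in>A. u \<noteq> v \<longrightarrow> in_arcs D u \<inter> in_arcs D v = {}"
      by (simp add: in_arcs_def disjoint_iff)
  qed
  finally show ?thesis
    by (simp add: in_degree_def)
qed

lemma sum_in_degree:
  assumes "orientation_of D G"
  shows "(\<Sum>v\<in>vertices G. in_degree D v) = card (edges G)"
proof -
  have "head D e \<in> vertices G" if "e \<in> edges G" for e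
  proof -
    have "{tail D e, head D e} = ends G e"
      using assms that by (simp add: orientation_of_def)
    then show ?thesis
      using ends_subset[OF that] by blast
  qed
  then have "{e \<in> edges G. head D e \<in> vertices G} = edges G"
    by blast
  then show ?thesis
    using card_heads_in_eq_sum_in_degree[OF assms subset_refl] by simp
qed

lemma set_in_degree_add_induced_edge_count:
  assumes "orientation_of D G" "A \<subseteq> vertices G"
  shows "set_in_degree D A + induced_edge_count G A = (\<Sum>v\<in>A. in_degree D v)"
proof -
  let ?entering = "{e \<in> edges G. tail D e \<notin> A \<and> head D e \<in> A}"
  let ?inside = "{e \<in> edges G. ends G e \<subseteq> A}"
  have "ends G e = {tail D e, head D e}" if "e \<in> edges G" for e
    using assms(1) that by (simp add: orientation_of_def)
  then have "{e \<in> edges G. head D e \<in> A} = ?entering \<union> ?inside" "?entering \<inter> ?inside = {}"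
    by auto
  then have "card ?entering + card ?inside = card {e \<in> edges G. head D e \<in> A}"
    using finite_edges by (simp add: card_Un_disjoint)
  also have "\<dots> = (\<Sum>v\<in>A. in_degree D v)"
    using assms by (rule card_heads_in_eq_sum_in_degree)
  finally show ?thesis
    using assms(1) by (simp add: set_in_degree_def induced_edge_count_def orientation_of_def)
qed

lemma ex_orientation_with_heads:
  assumes "\<And>e. e \<in> edges G \<Longrightarrow> h e \<in> ends G e"
  shows "\<exists>D. orientation_of D G \<and> head D = h"
proof -
  have "\<exists>t. {t, h e} = ends G e" if e: "e \<in> edges G" for e
  proof -
    have "card (ends G e - {h e}) = 1"
      using card_ends[OF e] assms[OF e] by simp
    then obtain t where t: "ends G e - {h e} = {t}"
      by (rule card_1_singletonE)
    have "insert (h e) (ends G e - {h e}) = ends G e"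
      using assms[OF e] by (rule insert_Diff)
    then show ?thesis
      unfolding t insert_commute[of "h e"] by (rule exI)
  qed
  then obtain t where t: "\<forall>e\<in>edges G. {t e, h e} = ends G e"
    using bchoice[of "edges G" "\<lambda>e t. {t, h e} = ends G e"] by blast
  show ?thesis
  proof (intro exI conjI)
    show "orientation_of \<lparr>verts = vertices G, arcs = edges G, tail = t, head = h\<rparr> G"
      using t by (simp add: orientation_of_def)
  qed simp
qed

lemma sparse_imp_ex_orientation_in_degree_le:
  assumes "sparse m (vertices G) (ends G) (edges G)"
  shows "\<exists>D. orientation_of D G \<and> (\<forall>v\<in>vertices G. in_degree D v \<le> m v)"
proof -
  obtain h where h: "\<forall>e\<in>edges G. h e \<in> ends G e"
    and fibres: "\<forall>v\<in>vertices G. card {e \<in> edges G. h e = v} \<le> m v"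
    using sparse_imp_ex_heads_card_le[OF finite_vertices finite_edges assms] by blast
  obtain D where "orientation_of D G" "head D = h"
    using ex_orientation_with_heads[of h] h by blast
  with fibres show ?thesis
    by (auto simp: in_degree_def in_arcs_def orientation_of_def)
qed

theorem ex_orientation_in_degree_eq_iff:
  "(\<exists>D. orientation_of D G \<and> (\<forall>v\<in>vertices G. in_degree D v = m v)) \<longleftrightarrow>
    sparse m (vertices G) (ends G) (edges G) \<and> card (edges G) = sum m (vertices G)"
proof (intro iffI conjI)
  assume "\<exists>D. orientation_of D G \<and> (\<forall>v\<in>vertices G. in_degree D v = m v)"
  then obtain D where D: "orientation_of D G" and m: "\<forall>v\<in>vertices G. in_degree D v = m v"
    by blast
  show "card (edges G) = sum m (vertices G)"
    using sum_in_degree[OF D] m by simp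
  have "induced_edge_count G X \<le> sum m X" if "X \<subseteq> vertices G" for X
  proof -
    have "induced_edge_count G X \<le> (\<Sum>v\<in>X. in_degree D v)"
      using set_in_degree_add_induced_edge_count[OF D that] by linarith
    also have "\<dots> = sum m X"
      using m that by (intro sum.cong) auto
    finally show ?thesis .
  qed
  then show "sparse m (vertices G) (ends G) (edges G)"
    by (simp add: sparse_def induced_edge_count_eq_card_spanned)
next
  assume "sparse m (vertices G) (ends G) (edges G) \<and> card (edges G) = sum m (vertices G)"
  then obtain D where D: "orientation_of D G"
    and le: "\<And>v. v \<in> vertices G \<Longrightarrow> in_degree D v \<le> m v"
    and total: "(\<Sum>v\<in>vertices G. in_degree D v) = sum m (vertices G)"
    using sparse_imp_ex_orientation_in_degree_le sum_in_degree by metis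
  have "in_degree D v = m v" if "v \<in> vertices G" for v
    using total le that finite_vertices by (rule sum_mono_inv)
  with D show "\<exists>D. orientation_of D G \<and> (\<forall>v\<in>vertices G. in_degree D v = m v)"
    by blast
qed

lemma minimally_rigid_imp_ex_orientation:
  fixes l :: "'v set \<Rightarrow> int"
  assumes rigid: "minimally_rigid l G"
    and nonneg: "\<And>A. A \<subseteq> vertices G \<Longrightarrow> 0 \<le> l A" and "l (vertices G) = 0"
  shows "\<exists>D. orientation_of D G \<and> (\<forall>v\<in>vertices G. int (in_degree D v) = l {v})"
proof -
  define m where "m v = nat (l {v})" for v
  have int_m: "int (m v) = l {v}" if "v \<in> vertices G" for v
    using nonneg[of "{v}"] that by (simp add: m_def)
  have int_sum_m: "int (sum m X) = (\<Sum>v\<in>X. l {v})" if "X \<subseteq> vertices G" for X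
    unfolding of_nat_sum using int_m that by (intro sum.cong) auto
  have "card (spanned (ends G) (edges G) X) \<le> sum m X" if "X \<subseteq> vertices G" for X
  proof -
    have "int (induced_edge_count G X) \<le> (\<Sum>v\<in>X. l {v}) - l X"
      using rigid that by (simp add: minimally_rigid_def)
    also have "\<dots> \<le> int (sum m X)"
      using nonneg[OF that] int_sum_m[OF that] by simp
    finally show ?thesis
      by (simp add: induced_edge_count_eq_card_spanned del: of_nat_sum)
  qed
  moreover have "card (edges G) = sum m (vertices G)"
    using rigid assms(3) int_sum_m[OF subset_refl]
    by (simp add: minimally_rigid_def del: of_nat_sum)
  ultimately obtain D where "orientation_of D G" "\<forall>v\<in>vertices G. in_degree D v = m v"
    using ex_orientation_in_degree_eq_iff[of m] by (auto simp: sparse_def)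
  with int_m show ?thesis by auto
qed

lemma minimally_rigid_iff_arc_connected:
  fixes l :: "'v set \<Rightarrow> int"
  assumes D: "orientation_of D G"
    and in_degree: "\<forall>v\<in>vertices G. int (in_degree D v) = l {v}" and "l (vertices G) = 0"
  shows "minimally_rigid l G \<longleftrightarrow> arc_connected l D"
proof -
  have sum_l: "(\<Sum>v\<in>X. l {v}) = int (\<Sum>v\<in>X. in_degree D v)" if "X \<subseteq> vertices G" for X
    unfolding of_nat_sum using in_degree that by (intro sum.cong) auto
  have "int (card (edges G)) = (\<Sum>v\<in>vertices G. l {v}) - l (vertices G)"
    using sum_l[OF subset_refl] sum_in_degree[OF D] assms(3) by simp
  moreover have "int (induced_edge_count G X) \<le> (\<Sum>v\<in>X. l {v}) - l X \<longleftrightarrow>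
      l X \<le> int (set_in_degree D X)" if "X \<subseteq> vertices G" for X
    using sum_l[OF that] set_in_degree_add_induced_edge_count[OF D that] by linarith
  moreover have "verts D = vertices G"
    using D by (simp add: orientation_of_def)
  ultimately show ?thesis
    by (simp add: minimally_rigid_def arc_connected_def)
qed

end

theorem theorem7p2:
  fixes G :: "('v, 'e) multigraph" and l :: "'v set \<Rightarrow> int"
  assumes "finite_multigraph G"
    and "\<And>A. A \<subseteq> vertices G \<Longrightarrow> 0 \<le> l A"
    and "weakly_subadditive_on (vertices G) l"
    and "l {} = 0" and "l (vertices G) = 0"
  shows "minimally_rigid l G \<longleftrightarrow>
    (\<exists>D. orientation_of D G \<and> arc_connected l D \<and>
         (\<forall>v\<in>vertices G. int (in_degree D v) = l {v}))"
proof -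
  interpret finite_multigraph G by fact
  have rigid_iff: "minimally_rigid l G \<longleftrightarrow> arc_connected l D"
    if "orientation_of D G" "\<forall>v\<in>vertices G. int (in_degree D v) = l {v}" for D
    using that assms(5) by (rule minimally_rigid_iff_arc_connected)
  have "\<exists>D. orientation_of D G \<and> (\<forall>v\<in>vertices G. int (in_degree D v) = l {v})"
    if "minimally_rigid l G"
    using that assms(2,5) by (rule minimally_rigid_imp_ex_orientation)
  with rigid_iff show ?thesis by blast
qed

end
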